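(* The following identity holds in $\mathbb Q(v)$ for every integer $d\ge1$: $$\sum_{\substack{k,m,r\in\mathbb N\\k+m+r=d}}(-1)^r\frac{v^{\binom{r+1}2-2(k-1)m}}{[r]!\,[2k]^{!!}\,[2m]^{!!}}=0.$$
   Context: $v$ is an indeterminate and $\mathbb N=\{0,1,2,\dots\}$. $[n]=\frac{v^n-v^{-n}}{v-v^{-1}}$, $[n]!=\prod_{s=1}^n[s]$, $[0]^{!!}=1$, $[2l]^{!!}=[2l][2l-2]\cdots[2]$. *)

theory Defs
  imports Complex_Main "HOL-Computational_Algebra.Polynomial" "HOL-Computational_Algebra.Fraction_Field"
begin

type_synonym ratfun = "rat poly fract"

definition v :: ratfun where
  "v = Fract [:0, 1:] 1"

definition qint :: "nat \<Rightarrow> ratfun" where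
  "qint n = (v powi (int n) - v powi (- int n)) / (v - inverse v)"

definition qfact :: "nat \<Rightarrow> ratfun" where
  "qfact n = (\<Prod>s = 1..n. qint s)"

text \<open>The double factorial is only needed at even arguments;
  \<open>qdfact_even l\<close> is $[2l]^{!!} = [2l][2l-2]\cdots[2]$, with $[0]^{!!} = 1$ the empty product.\<close>

definition qdfact_even :: "nat \<Rightarrow> ratfun" where
  "qdfact_even l = (\<Prod>s = 1..l. qint (2 * s))"

end

theory Submission
  imports Defs
begin

text \<open>
  Write \<open>A\<^sub>n\<close> for the sum of \<open>v\<^bsup>-2(k-1)m\<^esup> / ([2k]!![2m]!!)\<close> over \<open>k + m = n\<close> and
  \<open>b\<^sub>r = (-1)\<^sup>r v\<^bsup>r(r+1)/2\<^esup> / [r]!\<close>, so that the claim is that the convolution of \<open>A\<close> and \<open>b\<close>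
  vanishes in positive degree. Splitting \<open>[2n] = v\<^bsup>-2m\<^esup>[2k] + v\<^bsup>2k\<^esup>[2m]\<close> in every summand of
  \<open>[2n] A\<^sub>n\<close> and using the symmetry \<open>k \<leftrightarrow> m\<close> gives \<open>[n] A\<^sub>n = v\<^bsup>2-n\<^esup> A\<^bsub>n-1\<^esub>\<close>, while
  \<open>[r] b\<^sub>r = -v\<^sup>r b\<^bsub>r-1\<^esub>\<close>. Splitting \<open>[d] = v\<^sup>r[n] + v\<^bsup>-n\<^esup>[r]\<close> in every summand of
  \<open>[d] \<Sum> A\<^sub>n b\<^sub>r\<close> and applying the two recurrences, the two resulting sums over
  \<open>n + r = d - 1\<close> cancel term by term.
\<close>

lemma v_power: "v ^ n = Fract (monom 1 n) 1"
proof (induction n)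
  case (Suc n)
  have "[:0, 1:] * monom (1 :: rat) n = monom 1 (Suc n)"
    by (simp add: monom_Suc)
  with Suc show ?case by (simp add: v_def)
qed (simp add: One_fract_def)

lemma v_nonzero [simp]: "v \<noteq> 0"
  by (simp add: v_def Zero_fract_def eq_fract)

text \<open>Comparing degrees of polynomials shows that \<open>v\<close> is not a root of unity;
  every later division by a \<open>qint\<close> rests on this.\<close>

lemma v_power_neq_1:
  assumes "n > 0"
  shows "v ^ n \<noteq> 1"
proof
  assume "v ^ n = 1"
  then have "monom (1 :: rat) n = 1"
    by (simp add: v_power One_fract_def eq_fract)
  then have "degree (monom (1 :: rat) n) = 0"
    by (simp only: degree_1)
  with assms show False
    by (simp add: degree_monom_eq)
qed

lemma v_powi_diff_nonzero:
  assumes "n > 0"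
  shows "v powi int n - v powi (- int n) \<noteq> 0"
proof
  assume "v powi int n - v powi (- int n) = 0"
  then have "v ^ n = inverse (v ^ n)"
    by (simp add: power_int_minus)
  then have "v ^ n * v ^ n = 1"
    by (metis right_inverse v_nonzero power_not_zero)
  then have "v ^ (n + n) = 1"
    by (simp only: power_add)
  with assms v_power_neq_1 [of "n + n"] show False by simp
qed

lemma qint_nonzero:
  assumes "n > 0"
  shows "qint n \<noteq> 0"
  \<comment> \<open>The instance at 1 takes care of the denominator
    \<open>v - inverse v\<close>.\<close>
  using v_powi_diff_nonzero [of 1] v_powi_diff_nonzero [OF assms]
  by (simp add: qint_def power_int_minus)

lemma qint_0 [simp]: "qint 0 = 0"
  by (simp add: qint_def)

text \<open>The cross terms \<open>v powi (b - a)\<close> on the right cancel.\<close>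

lemma qint_add: "qint (a + b) = v powi int b * qint a + v powi (- int a) * qint b"
proof -
  have "v powi int (a + b) = v powi int b * v powi int a"
    and "v powi (- int (a + b)) = v powi (- int a) * v powi (- int b)"
    by (simp_all add: power_int_add power_int_diff power_int_minus field_simps)
  then have "v powi int (a + b) - v powi (- int (a + b)) =
      v powi int b * (v powi int a - v powi (- int a)) +
      v powi (- int a) * (v powi int b - v powi (- int b))"
    by algebra
  then show ?thesis
    by (simp only: qint_def times_divide_eq_right add_divide_distrib)
qed

lemma qint_add': "qint (a + b) = v powi (- int b) * qint a + v powi int a * qint b"
  using qint_add [of b a] by (simp add: add.commute)

lemma qint_double: "qint (2 * n) = (v powi int n + v powi (- int n)) * qint n"
  using qint_add [of n n] by (simp only: mult_2 distrib_right)

lemma qfact_Suc: "qfact (Suc n) = qint (Suc n) * qfact n"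
  by (simp add: qfact_def)

lemma qdfact_even_Suc: "qdfact_even (Suc n) = qint (2 * Suc n) * qdfact_even n"
  by (simp add: qdfact_even_def)

definition W :: "nat \<Rightarrow> nat \<Rightarrow> ratfun" where
  "W k m = v powi (- 2 * (int k - 1) * int m) / (qdfact_even k * qdfact_even m)"

definition A :: "nat \<Rightarrow> ratfun" where
  "A n = (\<Sum>k\<le>n. W k (n - k))"

definition B :: "nat \<Rightarrow> ratfun" where
  "B r = (-1) ^ r * v powi int ((r + 1) choose 2) / qfact r"

text \<open>After cancelling \<open>qint (2 * Suc k)\<close>, the exponent left is
  \<open>- 2 * m - 2 * k * m\<close>. Exchanging the arguments of \<open>W\<close> makes the
  remaining prefactor depend on \<open>k + m\<close> only, so it can leave the sum over an
  antidiagonal.\<close>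

lemma qint_W_Suc_left:
  "v powi (- 2 * int m) * (qint (2 * Suc k) * W (Suc k) m) = v powi (- 2 * int (k + m)) * W m k"
  using qint_nonzero [of "2 * Suc k"]
  by (simp add: W_def qdfact_even_Suc power_int_add [symmetric] del: mult_Suc_right)
     (simp add: algebra_simps)

lemma qint_W_Suc_right:
  "v powi (2 * int k) * (qint (2 * Suc m) * W k (Suc m)) = v powi 2 * W k m"
  using qint_nonzero [of "2 * Suc m"]
  by (simp add: W_def qdfact_even_Suc power_int_add [symmetric] del: mult_Suc_right)
     (simp add: algebra_simps power_int_add power_int_diff)

text \<open>Pascal's rule: the triangular exponent grows by \<open>Suc r\<close>.\<close>

lemma qint_B_Suc: "qint (Suc r) * B (Suc r) = - (v powi int (Suc r) * B r)"
proof -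
  have "Suc (Suc r) choose 2 = Suc r + (Suc r choose 2)"
    by (simp add: numeral_2_eq_2)
  then show ?thesis
    using qint_nonzero [of "Suc r"]
    by (simp add: B_def qfact_Suc power_int_add)
qed

text \<open>Serves for summands with a factor \<open>qint k\<close>, whose boundary term vanishes
  because \<open>qint 0 = 0\<close>; the next lemma does the same at the other end.\<close>

lemma sum_antidiagonal_Suc_left:
  fixes f :: "nat \<Rightarrow> nat \<Rightarrow> 'a :: comm_monoid_add"
  assumes "f 0 (Suc n) = 0"
  shows "(\<Sum>k\<le>Suc n. f k (Suc n - k)) = (\<Sum>k\<le>n. f (Suc k) (n - k))"
  by (subst sum.atMost_Suc_shift) (simp add: assms)

lemma sum_antidiagonal_Suc_right:
  fixes f :: "nat \<Rightarrow> nat \<Rightarrow> 'a :: comm_monoid_add"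
  assumes "f (Suc n) 0 = 0"
  shows "(\<Sum>k\<le>Suc n. f k (Suc n - k)) = (\<Sum>k\<le>n. f k (Suc (n - k)))"
  by (simp add: assms) (rule sum.cong, simp_all add: Suc_diff_le)

lemma sum_antidiagonal_swap:
  fixes f :: "nat \<Rightarrow> nat \<Rightarrow> 'a :: comm_monoid_add"
  shows "(\<Sum>k\<le>n. f (n - k) k) = (\<Sum>k\<le>n. f k (n - k))"
  by (rule sum.reindex_bij_witness [of _ "\<lambda>k. n - k" "\<lambda>k. n - k"]) auto

lemma qint_A_Suc: "qint (Suc n) * A (Suc n) = v powi (1 - int n) * A n"
proof -
  have "qint (2 * Suc n) * A (Suc n) =
      (\<Sum>k\<le>Suc n. v powi (- 2 * int (Suc n - k)) * (qint (2 * k) * W k (Suc n - k))) +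
      (\<Sum>k\<le>Suc n. v powi (2 * int k) * (qint (2 * (Suc n - k)) * W k (Suc n - k)))"
    unfolding A_def sum_distrib_left sum.distrib [symmetric]
  proof (rule sum.cong)
    fix k assume "k \<in> {..Suc n}"
    then have "2 * Suc n = 2 * k + 2 * (Suc n - k)" by auto
    then have "qint (2 * Suc n) = v powi (- 2 * int (Suc n - k)) * qint (2 * k)
        + v powi (2 * int k) * qint (2 * (Suc n - k))"
      using qint_add' [of "2 * k" "2 * (Suc n - k)"] by simp
    then show "qint (2 * Suc n) * W k (Suc n - k) =
        v powi (- 2 * int (Suc n - k)) * (qint (2 * k) * W k (Suc n - k)) +
        v powi (2 * int k) * (qint (2 * (Suc n - k)) * W k (Suc n - k))"
      by (simp only: distrib_right mult.assoc)
  qed simp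
  also have "(\<Sum>k\<le>Suc n. v powi (- 2 * int (Suc n - k)) * (qint (2 * k) * W k (Suc n - k))) =
      (\<Sum>k\<le>n. v powi (- 2 * int (n - k)) * (qint (2 * Suc k) * W (Suc k) (n - k)))"
    by (rule sum_antidiagonal_Suc_left
          [of "\<lambda>k m. v powi (- 2 * int m) * (qint (2 * k) * W k m)"]) simp
  also have "\<dots> = (\<Sum>k\<le>n. v powi (- 2 * int n) * W (n - k) k)"
    by (rule sum.cong) (simp_all only: qint_W_Suc_left atMost_iff le_add_diff_inverse)
  also have "\<dots> = v powi (- 2 * int n) * A n"
    by (simp only: sum_antidiagonal_swap [of W] A_def sum_distrib_left [symmetric])
  also have "(\<Sum>k\<le>Suc n. v powi (2 * int k) * (qint (2 * (Suc n - k)) * W k (Suc n - k))) =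
      (\<Sum>k\<le>n. v powi (2 * int k) * (qint (2 * Suc (n - k)) * W k (Suc (n - k))))"
    by (rule sum_antidiagonal_Suc_right
          [of "\<lambda>k m. v powi (2 * int k) * (qint (2 * m) * W k m)"]) simp
  also have "\<dots> = v powi 2 * A n"
    by (simp only: qint_W_Suc_right A_def sum_distrib_left)
  finally have "qint (2 * Suc n) * A (Suc n) = (v powi (- 2 * int n) + v powi 2) * A n"
    by (simp only: distrib_right)
  \<comment> \<open>The first factor is the quotient of \<open>qint (2 * Suc n)\<close> by
    \<open>qint (Suc n)\<close>, so it cancels on both sides.\<close>
  also have "v powi (- 2 * int n) + v powi 2 =
      (v powi int (Suc n) + v powi (- int (Suc n))) * v powi (1 - int n)"
    by (simp only: distrib_right power_int_add [symmetric] v_nonzero simp_thms)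
       (simp add: add.commute)
  finally have "(v powi int (Suc n) + v powi (- int (Suc n))) * (qint (Suc n) * A (Suc n)) =
      (v powi int (Suc n) + v powi (- int (Suc n))) * (v powi (1 - int n) * A n)"
    by (simp only: qint_double mult.assoc)
  moreover have "v powi int (Suc n) + v powi (- int (Suc n)) \<noteq> 0"
    using qint_nonzero [of "2 * Suc n"] unfolding qint_double by force
  ultimately show ?thesis
    using mult_cancel_left by blast
qed

lemma sum_A_B: "(\<Sum>n\<le>Suc d. A n * B (Suc d - n)) = 0"
proof -
  have "qint (Suc d) * (\<Sum>n\<le>Suc d. A n * B (Suc d - n)) =
      (\<Sum>n\<le>Suc d. v powi int (Suc d - n) * (qint n * A n) * B (Suc d - n)) +
      (\<Sum>n\<le>Suc d. v powi (- int n) * A n * (qint (Suc d - n) * B (Suc d - n)))"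
    unfolding sum_distrib_left sum.distrib [symmetric]
  proof (rule sum.cong)
    fix n assume "n \<in> {..Suc d}"
    then have "qint (Suc d) = v powi int (Suc d - n) * qint n
        + v powi (- int n) * qint (Suc d - n)"
      using qint_add [of n "Suc d - n"] by simp
    then show "qint (Suc d) * (A n * B (Suc d - n)) =
        v powi int (Suc d - n) * (qint n * A n) * B (Suc d - n) +
        v powi (- int n) * A n * (qint (Suc d - n) * B (Suc d - n))"
      by (simp only: distrib_left distrib_right mult_ac)
  qed simp
  also have "(\<Sum>n\<le>Suc d. v powi int (Suc d - n) * (qint n * A n) * B (Suc d - n)) =
      (\<Sum>n\<le>d. v powi int (d - n) * (qint (Suc n) * A (Suc n)) * B (d - n))"
    by (rule sum_antidiagonal_Suc_left
          [of "\<lambda>n r. v powi int r * (qint n * A n) * B r"]) simp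
  also have "(\<Sum>n\<le>Suc d. v powi (- int n) * A n * (qint (Suc d - n) * B (Suc d - n))) =
      (\<Sum>n\<le>d. v powi (- int n) * A n * (qint (Suc (d - n)) * B (Suc (d - n))))"
    by (rule sum_antidiagonal_Suc_right
          [of "\<lambda>n r. v powi (- int n) * A n * (qint r * B r)"]) simp
  also have "(\<Sum>n\<le>d. v powi int (d - n) * (qint (Suc n) * A (Suc n)) * B (d - n)) + \<dots> = 0"
    unfolding sum.distrib [symmetric]
  proof (rule sum.neutral, rule ballI)
    fix n
    \<comment> \<open>Both exponents equal \<open>int (d - n) + 1 - int n\<close>, so the two
      coefficients of \<open>A n * B (d - n)\<close> are opposite.\<close>
    have "v powi int (d - n) * v powi (1 - int n) = v powi (- int n) * v powi int (Suc (d - n))"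
      by (simp add: power_int_add power_int_diff power_int_minus field_simps)
    then show "v powi int (d - n) * (qint (Suc n) * A (Suc n)) * B (d - n) +
        v powi (- int n) * A n * (qint (Suc (d - n)) * B (Suc (d - n))) = 0"
      unfolding qint_A_Suc qint_B_Suc by algebra
  qed
  finally show ?thesis
    using qint_nonzero [of "Suc d"] by simp
qed

theorem lemma8p3:
  fixes d :: nat
  assumes "d \<ge> 1"
  shows "(\<Sum>(k, m, r) \<in> {(k :: nat, m :: nat, r :: nat). k + m + r = d}.
            (-1) ^ r * v powi (int ((r + 1) choose 2) - 2 * (int k - 1) * int m)
              / (qfact r * qdfact_even k * qdfact_even m)) = 0"
proof -
  have "(\<Sum>(k, m, r) \<in> {(k, m, r). k + m + r = d}.
            (-1) ^ r * v powi (int ((r + 1) choose 2) - 2 * (int k - 1) * int m)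
              / (qfact r * qdfact_even k * qdfact_even m)) =
      (\<Sum>(k, m, r) \<in> {(k, m, r). k + m + r = d}. W k m * B r)"
    by (rule sum.cong) (auto simp: W_def B_def power_int_add power_int_diff power_int_minus field_simps)
  \<comment> \<open>Triples are grouped by \<open>n = k + m\<close>, which forces
    \<open>r = d - n\<close>; the inner sum over \<open>k\<close> is then
    \<open>A n\<close>.\<close>
  also have "\<dots> = (\<Sum>(n, k) \<in> (SIGMA n:{..d}. {..n}). W k (n - k) * B (d - n))"
    by (rule sum.reindex_bij_witness
          [of _ "\<lambda>(n, k). (k, n - k, d - n)" "\<lambda>(k, m, r). (k + m, k)"]) auto
  also have "\<dots> = (\<Sum>n\<le>d. A n * B (d - n))"
    by (simp add: sum.Sigma [symmetric] A_def sum_distrib_right)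
  also have "\<dots> = 0"
    \<comment> \<open>Since \<open>d\<close> is positive, \<open>Suc (d - 1)\<close> is
      \<open>d\<close>.\<close>
    using assms sum_A_B [of "d - 1"] by simp
  finally show ?thesis .
qed

end
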